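(* Let $\mathcal{E}=\{e_i\}_{i=1}^{\infty}$ be an orthonormal basis of a (separable) real Hilbert space $H$, and consider the dictionary $\mathcal{D}:=\mathcal{E}^{\pm}=\{e_i\}_{i=1}^{\infty}\cup\{-e_i\}_{i=1}^{\infty}$ of $H$. Let $C=\{c_p\}_{p=1}^\infty$ be a sequence of positive real coefficients such that $\sum_{p=1}^{\infty}c_p=\infty$ and $\lim_{p\to\infty}c_p=0$. Then for every $f\in H$, all the possible greedy expansions of $f$ with respect to $\mathcal{D}$ with prescribed coefficients $C$ and weakening parameter $t=1$ converge to $f$.
   Context: Let $H$ be a real Hilbert space with inner product $\langle\cdot,\cdot\rangle$. A dictionary $\mathcal{D}\subset H$ is a set of unit-norm vectors whose linear span is dense in $H$. Greedy expansion with prescribed coefficients $C=\{c_n\}_{n=1}^\infty$, $c_n>0$, and weakening parameter $t=1$. For $f\in H$ put $f_0:=f$, $G_0:=0$. For $m\ge 1$, if $f_{m-1}\neq 0$, choose an element $\varphi_m\in\mathcal{D}$ such that $\langle f_{m-1},\varphi_m\rangle= \sup_{g\in\mathcal{D}}\langle f_{m-1},g\rangle$, and set $f_m:=f_{m-1}-c_m\varphi_m$, $G_m:=G_{m-1}+c_m\varphi_m$. The series $\sum_n c_n\varphi_n$ is called a greedy expansion of $f$. If $f_{m-1}=0$ the algorithm stops; the expansion is then the finite sum $G_{m-1}=f$ and is regarded as converging to $f$. The choice of $\varphi_m$ need not be unique, so $f$ may have several greedy expansions; the claim concerns every sequence of admissible choices. A greedy expansion converges to $f$ if $\lim_{m\to\infty}G_m=f$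 in norm, i.e. $\lim_{m\to\infty}\|f_m\|=0$. *)

theory Defs
  imports "HOL-Analysis.Analysis"
begin

definition orthonormal_basis :: "'i set \<Rightarrow> ('i \<Rightarrow> 'a::real_inner) \<Rightarrow> bool" where
  "orthonormal_basis I e \<longleftrightarrow>
     (\<forall>i\<in>I. \<forall>j\<in>I. inner (e i) (e j) = (if i = j then 1 else 0)) \<and>
     closure (span (e ` I)) = UNIV"

definition dictionary :: "'a::real_inner set \<Rightarrow> bool" where
  "dictionary D \<longleftrightarrow> (\<forall>g\<in>D. norm g = 1) \<and> closure (span D) = UNIV"

definition signed_family :: "'i set \<Rightarrow> ('i \<Rightarrow> 'a::real_inner) \<Rightarrow> 'a set" where
  "signed_family I e = e ` I \<union> (\<lambda>i. - e i) ` I"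

lemma dictionary_signed_family:
  assumes "orthonormal_basis I e"
  shows "dictionary (signed_family I e)"
proof -
  have "closure (span (e ` I)) \<subseteq> closure (span (signed_family I e))"
    by (intro closure_mono span_mono) (auto simp: signed_family_def)
  then show ?thesis
    using assms
    by (auto simp: orthonormal_basis_def dictionary_def signed_family_def norm_eq_1)
qed

text \<open>
  The coefficients \<open>c\<close> and the chosen elements \<open>\<phi>\<close> are indexed from 1; their values at 0 are never
  used. Stopping at a zero remainder is encoded by keeping the remainder and the partial sum
  constant from then on, so that a finite expansion converges to its last partial sum; the
  values of \<open>\<phi>\<close> after stopping are irrelevant.
\<close>

primrec greedy_remainder :: "(nat \<Rightarrow> real) \<Rightarrow> (nat \<Rightarrow> 'a::real_inner) \<Rightarrow> 'a \<Rightarrow> nat \<Rightarrow> 'a" where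
  "greedy_remainder c \<phi> f 0 = f"
| "greedy_remainder c \<phi> f (Suc m) =
     (if greedy_remainder c \<phi> f m = 0 then greedy_remainder c \<phi> f m
      else greedy_remainder c \<phi> f m - c (Suc m) *\<^sub>R \<phi> (Suc m))"

primrec greedy_sum :: "(nat \<Rightarrow> real) \<Rightarrow> (nat \<Rightarrow> 'a::real_inner) \<Rightarrow> 'a \<Rightarrow> nat \<Rightarrow> 'a" where
  "greedy_sum c \<phi> f 0 = 0"
| "greedy_sum c \<phi> f (Suc m) =
     (if greedy_remainder c \<phi> f m = 0 then greedy_sum c \<phi> f m
      else greedy_sum c \<phi> f m + c (Suc m) *\<^sub>R \<phi> (Suc m))"

lemma greedy_sum_add_remainder: "greedy_sum c \<phi> f m + greedy_remainder c \<phi> f m = f"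
  by (induction m) auto

text \<open>
  On a nonempty set of unit vectors the real-valued supremum is that of a nonempty bounded set,
  by the Cauchy--Schwarz inequality.
\<close>

definition greedy_expansion ::
  "'a::real_inner set \<Rightarrow> (nat \<Rightarrow> real) \<Rightarrow> 'a \<Rightarrow> (nat \<Rightarrow> 'a) \<Rightarrow> bool" where
  "greedy_expansion D c f \<phi> \<longleftrightarrow>
     (\<forall>m\<ge>1. greedy_remainder c \<phi> f (m - 1) \<noteq> 0 \<longrightarrow>
        \<phi> m \<in> D \<and>
        inner (greedy_remainder c \<phi> f (m - 1)) (\<phi> m) =
          (SUP g\<in>D. inner (greedy_remainder c \<phi> f (m - 1)) g))"

end

theory Submission
  imports Defs
begin

text \<open>
  Each step replaces a coordinate of maximal modulus \<open>x\<close> by one of modulus \<open>\<bar>x - c\<bar>\<close>. As long as some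
  coordinate exceeds \<open>\<delta> \<ge> c\<close>, the step lowers the squared norm by at least \<open>c \<delta>\<close>; since the
  coefficients have infinite sum and tend to zero, the remainders tend to zero coordinatewise,
  uniformly in the coordinate. To upgrade this to norm convergence we use that at any time all
  coordinates of the remainder, except possibly the one chosen last, are dominated by the
  corresponding coordinates of \<open>f\<close>. The tails of the remainders are thereby controlled by those
  of \<open>f\<close>, as in the dominated convergence theorem.
\<close>

section \<open>Orthonormal families and Parseval's identity\<close>

text \<open>Expand the square and complete it in each coordinate. The coefficients \<open>a\<close>
  are free because two choices matter later: the Fourier coefficients give Bessel's inequality,
  those of an approximating combination give the converse bound.\<close>

lemma orthonormal_residual_norm:
  fixes e :: "'i \<Rightarrow> 'a::real_inner"
  assumes "finite S" "\<And>i j. i \<in> S \<Longrightarrow> j \<in> S \<Longrightarrow> inner (e i) (e j) = (if i = j then 1 else 0)"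
  shows "(norm (v - (\<Sum>i\<in>S. a i *\<^sub>R e i)))\<^sup>2
           = (norm v)\<^sup>2 - (\<Sum>i\<in>S. (inner v (e i))\<^sup>2) + (\<Sum>i\<in>S. (inner v (e i) - a i)\<^sup>2)"
proof -
  let ?w = "\<Sum>i\<in>S. a i *\<^sub>R e i"
  have ww: "inner ?w ?w = (\<Sum>i\<in>S. (a i)\<^sup>2)"
  proof -
    have "inner ?w ?w = (\<Sum>i\<in>S. \<Sum>j\<in>S. a i * (a j * inner (e j) (e i)))"
      by (simp add: inner_sum_left inner_sum_right sum_distrib_left mult.left_commute)
    also have "\<dots> = (\<Sum>i\<in>S. \<Sum>j\<in>S. if i = j then (a i)\<^sup>2 else 0)"
      using assms(2) by (intro sum.cong refl) (auto simp: power2_eq_square)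
    also have "\<dots> = (\<Sum>i\<in>S. (a i)\<^sup>2)"
      using assms(1) by simp
    finally show ?thesis .
  qed
  have "(norm (v - ?w))\<^sup>2 = (norm v)\<^sup>2 - 2 * inner v ?w + inner ?w ?w"
    by (simp add: power2_norm_eq_inner inner_diff_left inner_diff_right inner_commute)
  also have "inner v ?w = (\<Sum>i\<in>S. a i * inner v (e i))"
    by (simp add: inner_sum_right)
  finally show ?thesis
    unfolding ww
    by (simp add: power2_diff sum.distrib sum_subtractf sum_distrib_left algebra_simps)
qed

text \<open>Bessel's inequality bounds the finite sums from above. Density of the span brings them
  above any \<open>b\<close> below the squared norm, since the defect of a finite sum is at most the
  squared distance from \<open>v\<close> to any combination of the same vectors.\<close>

lemma parseval_has_sum:
  fixes e :: "'i \<Rightarrow> 'a::real_inner"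
  assumes "orthonormal_basis I e"
  shows "((\<lambda>i. (inner v (e i))\<^sup>2) has_sum (norm v)\<^sup>2) I"
proof -
  have on: "\<And>i j. i \<in> I \<Longrightarrow> j \<in> I \<Longrightarrow> inner (e i) (e j) = (if i = j then 1 else 0)"
    and dense: "closure (span (e ` I)) = UNIV"
    using assms by (auto simp: orthonormal_basis_def)
  have resid: "(norm (v - (\<Sum>i\<in>S. a i *\<^sub>R e i)))\<^sup>2
        = (norm v)\<^sup>2 - (\<Sum>i\<in>S. (inner v (e i))\<^sup>2) + (\<Sum>i\<in>S. (inner v (e i) - a i)\<^sup>2)"
    if "finite S" "S \<subseteq> I" for S a
    using that on by (intro orthonormal_residual_norm) blast+
  have bessel: "(\<Sum>i\<in>S. (inner v (e i))\<^sup>2) \<le> (norm v)\<^sup>2" if "finite S" "S \<subseteq> I" for S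
    using resid[OF that, of "\<lambda>i. inner v (e i)"]
      zero_le_power2[of "norm (v - (\<Sum>i\<in>S. inner v (e i) *\<^sub>R e i))"] by simp
  show ?thesis
    unfolding has_sum_def
  proof (rule order_tendstoI)
    fix b assume b: "b < (norm v)\<^sup>2"
    \<comment> \<open>Chosen so that an element of the span within \<epsilon> of \<open>v\<close>
      leaves a squared residual smaller than the gap between \<open>b\<close> and the squared norm
      of \<open>v\<close>.\<close>
    define \<epsilon> where "\<epsilon> = sqrt ((norm v)\<^sup>2 - b)"
    have \<epsilon>: "\<epsilon> > 0" "\<epsilon>\<^sup>2 = (norm v)\<^sup>2 - b"
      using b by (auto simp: \<epsilon>_def)
    obtain w where w: "w \<in> span (e ` I)" "dist w v < \<epsilon>"
      using dense \<epsilon>(1) closure_approachable[of v "span (e ` I)"] by auto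
    have inj: "inj_on e I"
      by (rule inj_onI) (metis on zero_neq_one)
    obtain T u where T: "finite T" "T \<subseteq> e ` I" "w = (\<Sum>x\<in>T. u x *\<^sub>R x)"
      using w(1) unfolding span_explicit by auto
    obtain S where S: "S \<subseteq> I" "finite S" "T = e ` S"
      using T(1,2) by (meson finite_subset_image)
    \<comment> \<open>Injectivity of \<open>e\<close> lets the sum over vectors be rewritten as a
      sum over indices, the form to which \<open>resid\<close> applies.\<close>
    have "w = (\<Sum>i\<in>S. u (e i) *\<^sub>R e i)"
      unfolding T(3) S(3) using inj_on_subset[OF inj S(1)] by (simp add: sum.reindex)
    then have "(norm v)\<^sup>2 - (\<Sum>i\<in>S. (inner v (e i))\<^sup>2) \<le> (norm (v - w))\<^sup>2"
      using resid[OF S(2,1), of "\<lambda>i. u (e i)"] by (simp add: sum_nonneg)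
    also have "\<dots> < \<epsilon>\<^sup>2"
      using w(2) by (intro power_strict_mono) (auto simp: dist_norm norm_minus_commute)
    finally have "b < (\<Sum>i\<in>S. (inner v (e i))\<^sup>2)"
      using \<epsilon>(2) by simp
    then have "b < (\<Sum>i\<in>X. (inner v (e i))\<^sup>2)" if "finite X" "S \<subseteq> X" for X
      using sum_mono2[OF that, of "\<lambda>i. (inner v (e i))\<^sup>2"] by simp
    then show "\<forall>\<^sub>F X in finite_subsets_at_top I. b < (\<Sum>i\<in>X. (inner v (e i))\<^sup>2)"
      unfolding eventually_finite_subsets_at_top using S by blast
  next
    fix b assume "(norm v)\<^sup>2 < b"
    then show "\<forall>\<^sub>F X in finite_subsets_at_top I. (\<Sum>i\<in>X. (inner v (e i))\<^sup>2) < b"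
      by (intro eventually_finite_subsets_at_top_weakI) (use bessel in force)
  qed
qed

section \<open>The greedy step and domination by the coordinates of \<open>f\<close>\<close>

lemma norm_eq_1_signed_family:
  assumes "orthonormal_basis I e" "g \<in> signed_family I e"
  shows "norm g = 1"
  using dictionary_signed_family[OF assms(1)] assms(2) by (simp add: dictionary_def)

text \<open>The dictionary is symmetric, so maximizing the inner product over it amounts to
  maximizing the modulus of a coordinate; \<open>s\<close> is the sign with which the basis vector
  is taken.\<close>

lemma greedy_expansion_step:
  fixes e :: "'i \<Rightarrow> 'a::real_inner"
  assumes "orthonormal_basis I e" "greedy_expansion (signed_family I e) c f \<phi>"
    and "greedy_remainder c \<phi> f m \<noteq> 0"
  obtains i s where "i \<in> I" "s * s = 1"
    "greedy_remainder c \<phi> f (Suc m) = greedy_remainder c \<phi> f m - (c (Suc m) * s) *\<^sub>R e i"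
    "s * inner (greedy_remainder c \<phi> f m) (e i) = \<bar>inner (greedy_remainder c \<phi> f m) (e i)\<bar>"
    "\<And>j. j \<in> I \<Longrightarrow> \<bar>inner (greedy_remainder c \<phi> f m) (e j)\<bar> \<le> \<bar>inner (greedy_remainder c \<phi> f m) (e i)\<bar>"
proof -
  let ?r = "greedy_remainder c \<phi> f m"
  let ?D = "signed_family I e"
  have mem: "\<phi> (Suc m) \<in> ?D" and sup: "inner ?r (\<phi> (Suc m)) = (SUP g\<in>?D. inner ?r g)"
    using assms(2,3) unfolding greedy_expansion_def by (auto dest!: spec[of _ "Suc m"])
  \<comment> \<open>Boundedness is what makes the real \<open>SUP\<close> an actual upper
    bound.\<close>
  have "bdd_above (inner ?r ` ?D)"
    by (rule bdd_aboveI2[where M = "norm ?r"])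
      (metis norm_cauchy_schwarz norm_eq_1_signed_family[OF assms(1)] mult.right_neutral)
  then have max: "inner ?r g \<le> inner ?r (\<phi> (Suc m))" if "g \<in> ?D" for g
    unfolding sup using that by (intro cSUP_upper)
  have abs_le: "\<bar>inner ?r (e j)\<bar> \<le> inner ?r (\<phi> (Suc m))" if "j \<in> I" for j
    using max[of "e j"] max[of "- e j"] that by (auto simp: signed_family_def)
  obtain i s where i: "i \<in> I" and s: "s = 1 \<or> s = -1" and \<phi>: "\<phi> (Suc m) = s *\<^sub>R e i"
  proof (cases "\<phi> (Suc m) \<in> e ` I")
    case True
    then show ?thesis by (auto intro: that[of _ 1])
  next
    case False
    then show ?thesis using mem by (auto simp: signed_family_def intro: that[of _ "-1"])
  qed
  \<comment> \<open>The selected inner product equals \<open>s * inner ?r (e i)\<close> and is at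
    least the modulus of that coordinate, so it is nonnegative.\<close>
  have abs_eq: "s * inner ?r (e i) = \<bar>inner ?r (e i)\<bar>"
    using abs_le[OF i] s by (auto simp: \<phi>)
  show ?thesis
  proof (rule that[OF i _ _ abs_eq])
    show "\<bar>inner ?r (e j)\<bar> \<le> \<bar>inner ?r (e i)\<bar>" if "j \<in> I" for j
      using abs_le[OF that] abs_eq by (simp add: \<phi>)
  qed (use s assms(3) \<phi> in auto)
qed

lemma inner_orthonormal_step:
  assumes "orthonormal_basis I e" "i \<in> I" "j \<in> I"
  shows "inner (r - a *\<^sub>R e i) (e j) = inner r (e j) - (if j = i then a else 0)"
  using assms by (auto simp: orthonormal_basis_def inner_diff_left)

lemma abs_diff_sign:
  fixes s x a :: real
  assumes "s * s = 1" "s * x = \<bar>x\<bar>"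
  shows "\<bar>x - a * s\<bar> = \<bar>\<bar>x\<bar> - a\<bar>"
proof -
  have "\<bar>s\<bar> = 1"
    using assms(1) by (auto simp: square_eq_1_iff)
  then have "\<bar>x - a * s\<bar> = \<bar>s * (x - a * s)\<bar>"
    by (simp add: abs_mult)
  also have "s * (x - a * s) = s * x - a * (s * s)"
    by (simp add: algebra_simps)
  finally show ?thesis
    using assms by simp
qed

text \<open>
  Here \<open>L\<close> is the smallest maximal modulus seen so far and \<open>k\<close> is the coordinate chosen last:
  a coordinate that has been modified was at least \<open>L\<close> originally, while apart from the
  \<open>k\<close>-th every coordinate is at most \<open>L\<close> now.
\<close>

lemma greedy_remainder_dominated_strong:
  fixes e :: "'i \<Rightarrow> 'a::real_inner"
  assumes "orthonormal_basis I e" "greedy_expansion (signed_family I e) c f \<phi>"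
  shows "\<exists>k L. \<forall>j\<in>I.
     (L \<le> \<bar>inner f (e j)\<bar> \<or> inner (greedy_remainder c \<phi> f m) (e j) = inner f (e j)) \<and>
     (j \<noteq> k \<longrightarrow> \<bar>inner (greedy_remainder c \<phi> f m) (e j)\<bar> \<le> L \<and>
               \<bar>inner (greedy_remainder c \<phi> f m) (e j)\<bar> \<le> \<bar>inner f (e j)\<bar>)"
proof (induction m)
  case 0
  \<comment> \<open>Initially \<open>L\<close> can be \<open>norm f\<close>: no coordinate has been
    modified and all are bounded by it.\<close>
  have "\<bar>inner f (e j)\<bar> \<le> norm f" if "j \<in> I" for j
    using Cauchy_Schwarz_ineq2[of f "e j"] norm_eq_1_signed_family[OF assms(1), of "e j"] that
    by (auto simp: signed_family_def)
  then show ?case by auto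
next
  case (Suc m)
  let ?r = "greedy_remainder c \<phi> f m"
  show ?case
  proof (cases "?r = 0")
    case True
    with Suc show ?thesis by simp
  next
    case False
    obtain k L where IH: "\<forall>j\<in>I. (L \<le> \<bar>inner f (e j)\<bar> \<or> inner ?r (e j) = inner f (e j)) \<and>
       (j \<noteq> k \<longrightarrow> \<bar>inner ?r (e j)\<bar> \<le> L \<and> \<bar>inner ?r (e j)\<bar> \<le> \<bar>inner f (e j)\<bar>)"
      using Suc by blast
    obtain i s where i: "i \<in> I"
      and step: "greedy_remainder c \<phi> f (Suc m) = ?r - (c (Suc m) * s) *\<^sub>R e i"
      and max: "\<And>j. j \<in> I \<Longrightarrow> \<bar>inner ?r (e j)\<bar> \<le> \<bar>inner ?r (e i)\<bar>"
      using greedy_expansion_step[OF assms False] by metis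
    show ?thesis
    \<comment> \<open>The coordinate chosen now becomes the exceptional one, and \<open>L\<close> is
      lowered to the current maximal modulus if that is smaller.\<close>
    proof (intro exI[of _ i] exI[of _ "min L \<bar>inner ?r (e i)\<bar>"] ballI)
      fix j assume j: "j \<in> I"
      show "(min L \<bar>inner ?r (e i)\<bar> \<le> \<bar>inner f (e j)\<bar> \<or>
              inner (greedy_remainder c \<phi> f (Suc m)) (e j) = inner f (e j)) \<and>
            (j \<noteq> i \<longrightarrow>
              \<bar>inner (greedy_remainder c \<phi> f (Suc m)) (e j)\<bar> \<le> min L \<bar>inner ?r (e i)\<bar> \<and>
              \<bar>inner (greedy_remainder c \<phi> f (Suc m)) (e j)\<bar> \<le> \<bar>inner f (e j)\<bar>)"
        \<comment> \<open>The delicate case is \<open>j = k\<close> with \<open>k\<close> different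
          from \<open>i\<close>: the former exceptional coordinate must now be dominated. Either it
          still has its original value, or its modulus is at most that of coordinate
          \<open>i\<close>, hence at most \<open>L\<close>, hence at most its original
          modulus.\<close>
        using IH[rule_format, OF j] IH[rule_format, OF i] max[OF j]
        unfolding step inner_orthonormal_step[OF assms(1) i j]
        by (cases "j = i"; cases "j = k") auto
    qed
  qed
qed

lemma greedy_remainder_dominated:
  fixes e :: "'i \<Rightarrow> 'a::real_inner"
  assumes "orthonormal_basis I e" "greedy_expansion (signed_family I e) c f \<phi>"
  obtains k where
    "\<And>j. j \<in> I \<Longrightarrow> j \<noteq> k \<Longrightarrow> \<bar>inner (greedy_remainder c \<phi> f m) (e j)\<bar> \<le> \<bar>inner f (e j)\<bar>"
  using greedy_remainder_dominated_strong[OF assms, of m] by blast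

section \<open>Uniform smallness of the coordinates\<close>

text \<open>Only one coordinate changes, and its modulus becomes the distance between two numbers of
  the interval from 0 to \<delta>.\<close>

lemma greedy_remainder_coordinates_le_step:
  fixes e :: "'i \<Rightarrow> 'a::real_inner"
  assumes "orthonormal_basis I e" "greedy_expansion (signed_family I e) c f \<phi>"
    and "0 < c (Suc m)" "c (Suc m) \<le> \<delta>"
    and "\<And>j. j \<in> I \<Longrightarrow> \<bar>inner (greedy_remainder c \<phi> f m) (e j)\<bar> \<le> \<delta>"
    and "j \<in> I"
  shows "\<bar>inner (greedy_remainder c \<phi> f (Suc m)) (e j)\<bar> \<le> \<delta>"
proof (cases "greedy_remainder c \<phi> f m = 0")
  case True
  then show ?thesis using assms(5,6) by simp
next
  case False
  let ?r = "greedy_remainder c \<phi> f m"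
  obtain i s where i: "i \<in> I" and s: "s * s = 1" "s * inner ?r (e i) = \<bar>inner ?r (e i)\<bar>"
    and step: "greedy_remainder c \<phi> f (Suc m) = ?r - (c (Suc m) * s) *\<^sub>R e i"
    using greedy_expansion_step[OF assms(1,2) False] by metis
  show ?thesis
    unfolding step inner_orthonormal_step[OF assms(1) i assms(6)]
    using assms(3,4) assms(5)[OF i] assms(5)[OF assms(6)] abs_diff_sign[OF s, of "c (Suc m)"]
    by (cases "j = i") auto
qed

text \<open>With \<open>M\<close> the largest modulus, the squared norm drops by
  \<open>c * (2 * M - c) = c * M + c * (M - c)\<close>. Since \<open>c \<le> \<delta> < M\<close>,
  the first term is at least \<open>\<delta> * c\<close> and the second is nonnegative.\<close>

lemma greedy_remainder_norm_decrease:
  fixes e :: "'i \<Rightarrow> 'a::real_inner"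
  assumes "orthonormal_basis I e" "greedy_expansion (signed_family I e) c f \<phi>"
    and "0 < c (Suc m)" "c (Suc m) \<le> \<delta>"
    and "j \<in> I" "\<delta> < \<bar>inner (greedy_remainder c \<phi> f m) (e j)\<bar>"
  shows "(norm (greedy_remainder c \<phi> f (Suc m)))\<^sup>2
           \<le> (norm (greedy_remainder c \<phi> f m))\<^sup>2 - \<delta> * c (Suc m)"
proof -
  let ?r = "greedy_remainder c \<phi> f m"
  have "?r \<noteq> 0"
    using assms(3,4,6) by auto
  from greedy_expansion_step[OF assms(1,2) this]
  obtain i s where i: "i \<in> I" and s: "s * s = 1" "s * inner ?r (e i) = \<bar>inner ?r (e i)\<bar>"
    and step: "greedy_remainder c \<phi> f (Suc m) = ?r - (c (Suc m) * s) *\<^sub>R e i"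
    and max: "\<bar>inner ?r (e j)\<bar> \<le> \<bar>inner ?r (e i)\<bar>"
    using assms(5) by metis
  let ?M = "\<bar>inner ?r (e i)\<bar>" and ?c = "c (Suc m)"
  have ee: "inner (e i) (e i) = 1"
    using assms(1) i by (simp add: orthonormal_basis_def)
  have "(norm (greedy_remainder c \<phi> f (Suc m)))\<^sup>2
          = (norm ?r)\<^sup>2 - 2 * ?c * (s * inner ?r (e i)) + ?c * ?c * (s * s)"
    unfolding step power2_norm_eq_inner
    by (simp add: inner_diff_left inner_diff_right inner_commute[of "e i" ?r] ee algebra_simps)
  also have "\<dots> = (norm ?r)\<^sup>2 - ?c * ?M - ?c * (?M - ?c)"
    by (simp add: s algebra_simps)
  also have "\<dots> \<le> (norm ?r)\<^sup>2 - ?c * \<delta> - 0"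
    using assms(3,4,6) max by (intro diff_mono mult_left_mono mult_nonneg_nonneg) auto
  finally show ?thesis
    by (simp add: mult.commute)
qed

lemma greedy_remainder_coordinates_uniformly_small:
  fixes e :: "'i \<Rightarrow> 'a::real_inner"
  assumes "orthonormal_basis I e" "greedy_expansion (signed_family I e) c f \<phi>"
    and pos: "\<And>p. p \<ge> 1 \<Longrightarrow> c p > 0"
    and div: "filterlim (\<lambda>n. \<Sum>p=1..n. c p) at_top sequentially"
    and null: "c \<longlonglongrightarrow> 0" and "\<delta> > 0"
  shows "\<forall>\<^sub>F m in sequentially. \<forall>j\<in>I. \<bar>inner (greedy_remainder c \<phi> f m) (e j)\<bar> \<le> \<delta>"
proof -
  let ?r = "greedy_remainder c \<phi> f"
  obtain N where N: "\<And>m. m \<ge> N \<Longrightarrow> c m \<le> \<delta>"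
    using order_tendstoD(2)[OF null \<open>\<delta> > 0\<close>] unfolding eventually_sequentially
    by (meson less_imp_le)
  \<comment> \<open>One good time beyond \<open>N\<close> suffices: from then on every coefficient
    is at most \<delta>, so the bound is preserved.\<close>
  have "\<exists>m\<ge>N. \<forall>j\<in>I. \<bar>inner (?r m) (e j)\<bar> \<le> \<delta>"
  proof (rule ccontr)
    assume "\<not> ?thesis"
    then have big: "\<exists>j\<in>I. \<delta> < \<bar>inner (?r m) (e j)\<bar>" if "m \<ge> N" for m
      using that by (meson not_le)
    \<comment> \<open>While some coordinate exceeds \<delta>, the squared norm plus \<delta> times
      the partial sum of coefficients does not increase. This bounds the partial sums, against their
      divergence.\<close>
    have bound: "(norm (?r n))\<^sup>2 + \<delta> * (\<Sum>p=1..n. c p) \<le> (norm (?r N))\<^sup>2 + \<delta> * (\<Sum>p=1..N. c p)"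
      if "n \<ge> N" for n
      using that
    proof (induction n rule: dec_induct)
      case (step n)
      obtain j where "j \<in> I" "\<delta> < \<bar>inner (?r n) (e j)\<bar>"
        using big step.hyps by blast
      then have "(norm (?r (Suc n)))\<^sup>2 \<le> (norm (?r n))\<^sup>2 - \<delta> * c (Suc n)"
        using step.hyps by (intro greedy_remainder_norm_decrease[OF assms(1,2)] pos N) auto
      with step.IH show ?case
        by (simp add: distrib_left del: greedy_remainder.simps)
    qed simp
    define B where "B = ((norm (?r N))\<^sup>2 + \<delta> * (\<Sum>p=1..N. c p)) / \<delta>"
    have "(\<Sum>p=1..n. c p) \<le> B" if "n \<ge> N" for n
    proof -
      have "\<delta> * (\<Sum>p=1..n. c p) \<le> (norm (?r N))\<^sup>2 + \<delta> * (\<Sum>p=1..N. c p)"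
        using bound[OF that] by (smt (verit) zero_le_power2)
      then show ?thesis
        using \<open>\<delta> > 0\<close> by (simp add: B_def field_simps)
    qed
    moreover have "\<forall>\<^sub>F n in sequentially. B < (\<Sum>p=1..n. c p)"
      using div by (simp add: filterlim_at_top_dense)
    ultimately show False
      unfolding eventually_sequentially by (meson le_cases not_le)
  qed
  then obtain m0 where m0: "m0 \<ge> N" "\<forall>j\<in>I. \<bar>inner (?r m0) (e j)\<bar> \<le> \<delta>"
    by blast
  have "\<forall>j\<in>I. \<bar>inner (?r m) (e j)\<bar> \<le> \<delta>" if "m \<ge> m0" for m
    using that
  proof (induction m rule: dec_induct)
    case base
    then show ?case using m0(2) .
  next
    case (step m)
    then show ?case
      using m0(1) by (intro ballI greedy_remainder_coordinates_le_step[OF assms(1,2)] pos N) auto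
  qed
  then show ?thesis
    unfolding eventually_sequentially by blast
qed

section \<open>From coordinatewise smallness to norm convergence\<close>

text \<open>Split the coordinates of \<open>g\<close>: those in \<open>S\<close> and the exceptional
  \<open>k\<close> contribute at most \<delta> squared each, whence \<open>card S + 1\<close>; the
  others are dominated by the tail of \<open>f\<close> outside \<open>S\<close>.\<close>

lemma norm_le_of_dominated_coordinates:
  fixes e :: "'i \<Rightarrow> 'a::real_inner"
  assumes "orthonormal_basis I e" "finite S" "S \<subseteq> I"
    and small: "\<And>j. j \<in> I \<Longrightarrow> \<bar>inner g (e j)\<bar> \<le> \<delta>"
    and dom: "\<And>j. j \<in> I \<Longrightarrow> j \<noteq> k \<Longrightarrow> \<bar>inner g (e j)\<bar> \<le> \<bar>inner f (e j)\<bar>"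
  shows "(norm g)\<^sup>2 \<le> real (card S + 1) * \<delta>\<^sup>2 + ((norm f)\<^sup>2 - (\<Sum>j\<in>S. (inner f (e j))\<^sup>2))"
proof (rule has_sum_le_finite_sums[OF parseval_has_sum[OF assms(1)]])
  fix X assume X: "finite X" "X \<subseteq> I"
  let ?a = "\<lambda>j. (inner g (e j))\<^sup>2" and ?b = "\<lambda>j. (inner f (e j))\<^sup>2"
  have a_small: "?a j \<le> \<delta>\<^sup>2" if "j \<in> I" for j
    using small[OF that] by (metis abs_ge_zero power2_abs power_mono)
  have a_dom: "?a j \<le> ?b j" if "j \<in> I" "j \<noteq> k" for j
    using dom[OF that] by (simp add: abs_le_square_iff)
  \<comment> \<open>Enlarging \<open>X\<close> separates the two groups; the intersection with
    \<open>I\<close> is there because \<open>k\<close> may lie outside \<open>I\<close>.\<close>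
  have "sum ?a X \<le> sum ?a (insert k S \<inter> I \<union> (X - S - {k}))"
    using X assms(2) by (intro sum_mono2) auto
  also have "\<dots> = sum ?a (insert k S \<inter> I) + sum ?a (X - S - {k})"
    using X assms(2) by (intro sum.union_disjoint) auto
  also have "sum ?a (insert k S \<inter> I) \<le> real (card (insert k S \<inter> I)) * \<delta>\<^sup>2"
    using a_small by (intro sum_bounded_above) auto
  also have "\<dots> \<le> real (card S + 1) * \<delta>\<^sup>2"
  proof -
    have "card (insert k S \<inter> I) \<le> card (insert k S)"
      using assms(2) by (intro card_mono) auto
    also have "\<dots> \<le> card S + 1"
      by (simp add: card_insert_le_m1 card_insert_if assms(2))
    finally show ?thesis
      by (intro mult_right_mono) (auto simp del: of_nat_add)
  qed
  also have "sum ?a (X - S - {k}) \<le> sum ?b (X - S - {k})"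
    using X a_dom by (intro sum_mono) auto
  also have "\<dots> \<le> (norm f)\<^sup>2 - sum ?b S"
  proof -
    have "sum ?b (X - S - {k}) + sum ?b S = sum ?b ((X - S - {k}) \<union> S)"
      using X assms(2) by (intro sum.union_disjoint[symmetric]) auto
    also have "\<dots> \<le> (norm f)\<^sup>2"
      using X assms(2,3)
      by (intro finite_sum_le_has_sum[OF parseval_has_sum[OF assms(1)]]) auto
    finally show ?thesis by simp
  qed
  finally show "sum ?a X \<le> real (card S + 1) * \<delta>\<^sup>2 + ((norm f)\<^sup>2 - sum ?b S)"
    by simp
qed

lemma greedy_remainder_tendsto_0:
  fixes e :: "'i \<Rightarrow> 'a::real_inner"
  assumes "orthonormal_basis I e" "greedy_expansion (signed_family I e) c f \<phi>"
    and "\<And>p. p \<ge> 1 \<Longrightarrow> c p > 0"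
    and "filterlim (\<lambda>n. \<Sum>p=1..n. c p) at_top sequentially"
    and "c \<longlonglongrightarrow> 0"
  shows "greedy_remainder c \<phi> f \<longlonglongrightarrow> 0"
proof (rule tendstoI)
  fix \<epsilon> :: real assume "\<epsilon> > 0"
  let ?r = "greedy_remainder c \<phi> f"
  \<comment> \<open>By Parseval, a finite set \<open>S\<close> captures all but half of the allowed
    squared error.\<close>
  have "\<forall>\<^sub>F S in finite_subsets_at_top I.
          (norm f)\<^sup>2 - \<epsilon>\<^sup>2 / 2 < (\<Sum>j\<in>S. (inner f (e j))\<^sup>2)"
    using parseval_has_sum[OF assms(1), of f] \<open>\<epsilon> > 0\<close> unfolding has_sum_def
    by (intro order_tendstoD(1)) auto
  then obtain S where S: "finite S" "S \<subseteq> I"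
    "(norm f)\<^sup>2 - (\<Sum>j\<in>S. (inner f (e j))\<^sup>2) < \<epsilon>\<^sup>2 / 2"
    unfolding eventually_finite_subsets_at_top by (metis diff_less_eq add.commute order_refl)
  \<comment> \<open>Chosen so that the \<open>card S + 1\<close> coordinates estimated by \<delta>
    use up exactly the other half.\<close>
  define \<delta> where "\<delta> = sqrt (\<epsilon>\<^sup>2 / (2 * real (card S + 1)))"
  have \<delta>: "\<delta> > 0" "real (card S + 1) * \<delta>\<^sup>2 = \<epsilon>\<^sup>2 / 2"
    using \<open>\<epsilon> > 0\<close> by (auto simp: \<delta>_def field_simps add_pos_nonneg add_nonneg_eq_0_iff)
  show "\<forall>\<^sub>F m in sequentially. dist (?r m) 0 < \<epsilon>"
  proof (rule eventually_mono)
    show "\<forall>\<^sub>F m in sequentially. \<forall>j\<in>I. \<bar>inner (?r m) (e j)\<bar> \<le> \<delta>"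
      by (rule greedy_remainder_coordinates_uniformly_small) (use assms \<delta>(1) in auto)
  next
    fix m assume small: "\<forall>j\<in>I. \<bar>inner (?r m) (e j)\<bar> \<le> \<delta>"
    obtain k where
      "\<And>j. j \<in> I \<Longrightarrow> j \<noteq> k \<Longrightarrow> \<bar>inner (?r m) (e j)\<bar> \<le> \<bar>inner f (e j)\<bar>"
      using greedy_remainder_dominated[OF assms(1,2)] by blast
    then have "(norm (?r m))\<^sup>2
        \<le> real (card S + 1) * \<delta>\<^sup>2 + ((norm f)\<^sup>2 - (\<Sum>j\<in>S. (inner f (e j))\<^sup>2))"
      using small by (intro norm_le_of_dominated_coordinates[OF assms(1) S(1,2)]) auto
    then have "(norm (?r m))\<^sup>2 < \<epsilon>\<^sup>2"
      using \<delta>(2) S(3) by simp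
    then show "dist (?r m) 0 < \<epsilon>"
      using \<open>\<epsilon> > 0\<close> by (simp add: power_less_imp_less_base)
  qed
qed

theorem theorem3p2:
  fixes e :: "nat \<Rightarrow> 'a::{real_inner, complete_space}"
    and c :: "nat \<Rightarrow> real"
  assumes "orthonormal_basis {1..} e"
    and "\<And>p. p \<ge> 1 \<Longrightarrow> c p > 0"
    and "filterlim (\<lambda>n. \<Sum>p=1..n. c p) at_top sequentially"
    and "c \<longlonglongrightarrow> 0"
  shows "\<forall>f \<phi>. greedy_expansion (signed_family {1..} e) c f \<phi> \<longrightarrow>
           greedy_sum c \<phi> f \<longlonglongrightarrow> f"
proof (intro allI impI)
  fix f \<phi> assume "greedy_expansion (signed_family {1..} e) c f \<phi>"
  then have "(\<lambda>m. f - greedy_remainder c \<phi> f m) \<longlonglongrightarrow> f - 0"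
    by (intro tendsto_diff tendsto_const greedy_remainder_tendsto_0[OF assms(1) _ assms(2-4)])
  moreover have "f - greedy_remainder c \<phi> f m = greedy_sum c \<phi> f m" for m
    using greedy_sum_add_remainder[of c \<phi> f m] by (simp add: algebra_simps)
  ultimately show "greedy_sum c \<phi> f \<longlonglongrightarrow> f"
    by simp
qed

end
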